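(* Let $\mathbf T$ be a troupe. Let $f_1,\ldots,f_r$ be insertion-additive tree statistics, and let $x_1,\ldots,x_r$ be variables. If $d$ is a right-bound descent of a nonempty permutation $\pi$, then \[\sum_{\mathcal T\in \mathcal P^{-1}(\pi)\cap\mathsf D\mathbf T}x_1^{\ddot f_1(\mathcal T)}\cdots x_r^{\ddot f_r(\mathcal T)}\] \[=\sum_{H\in\mathrm{SW}_d(\pi)}\left(\sum_{\mathcal T_U\in \mathcal P^{-1}(\pi_U^H)\cap\mathsf D\mathbf T}x_1^{\ddot f_1(\mathcal T_U)}\cdots x_r^{\ddot f_r(\mathcal T_U)}\right)\left(\sum_{\mathcal T_S\in \mathcal P^{-1}(\pi_S^H)\cap\mathsf D\mathbf T}x_1^{\ddot f_1(\mathcal T_S)}\cdots x_r^{\ddot f_r(\mathcal T_S)}\right).\]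
   Context: Trees and troupes. Fix a finite set $\mathbf C$ of colors containing black and white. A binary plane tree is a finite (possibly empty) rooted tree in which every vertex has at most two children, every child is designated as either a left child or a right child (not both), and no vertex has two left children or two right children. A colored binary plane tree is a binary plane tree together with a function from its vertex set to $\mathbf C$; trees are considered up to isomorphism, and $\mathsf{CBPT}$ is the set of colored binary plane trees. Insertion: for nonempty $T_1,T_2\in\mathsf{CBPT}$ and a vertex $v$ of $T_1$, replace $v$ by two vertices joined by a left edge: the lower one is still called $v$ (it keeps the color and the left/right subtrees of $v$), and the upper one $v^*$ is black, takes the place of $v$ with respect to the parent of $v$ (if any), and has $v$ as left child; then attach $T_2$ as the right subtree of $v^*$. The result is $\nabla_v(T_1,T_2)$. Decomposition: if $v^*$ is a black vertex with $2$ children in $T$, let $v$ be its left child and $T_2$ its right subtree; delete $T_2$ and contract the edge $vv^*$ to a single vertex identified with $v$ (with the color of $v$), giving $T_1$; then $\Delta_{v^*}(T)=(T_1,T_2)$. A troupe is a set $\mathbf T\subseteq\mathsf{CBPT}$ such that: (i) $\nabla_v(T_1,T_2)\in\mathbf T$ for all nonempty $T_1,T_2\in\mathbf T$ and all vertices $v$ of $T_1$; (ii) $\Delta_{v^*}(T)\in\mathbf T\times\mathbf T$ for every $T\in\mathbf T$ and every black vertex $v^*$ of $T$ with $2$ children; (iii) for every $T\in\mathbf T$, all vertices of $T$ with $2$ children are black. Statistics. A tree statistic is a function $f:\mathsf{CBPT}\to\mathbb C$; it is insertion-additive if $f(\nabla_v(T_1,T_2))=f(T_1)+f(T_2)$ for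 all nonempty $T_1,T_2\in\mathsf{CBPT}$ and all vertices $v$ of $T_1$. Monomials $x_1^{a_1}\cdots x_r^{a_r}$ are commuting formal powers with $x_i^ax_i^b=x_i^{a+b}$. Decreasing trees and postorder. A decreasing colored binary plane tree is a colored binary plane tree whose vertices are bijectively labeled by a finite set of positive integers such that each nonroot vertex has a smaller label than its parent. Its skeleton $\mathrm{skel}(\mathcal T)$ is the colored binary plane tree obtained by removing labels. $\mathsf D\mathbf T$ is the set of decreasing colored binary plane trees whose skeleton lies in $\mathbf T$. Put $\ddot f(\mathcal T)=f(\mathrm{skel}(\mathcal T))$. The postorder reading $\mathcal P$ is defined recursively: $\mathcal P$ of the empty tree is the empty permutation, and $\mathcal P(\mathcal T)=\mathcal P(\mathcal T_L)\,\mathcal P(\mathcal T_R)\,m$ if $\mathcal T$ has root label $m$ and left and right subtrees $\mathcal T_L,\mathcal T_R$. $\mathcal P^{-1}(\pi)\cap\mathsf D\mathbf T$ is the set of $\mathcal T\in\mathsf D\mathbf T$ with $\mathcal P(\mathcal T)=\pi$. Permutations and hooks. A permutation is an ordering $\pi=\pi_1\cdots\pi_n$ of a finite set of positive integers. A descent of $\pi$ is an index $i\in\{1,\dots,n-1\}$ with $\pi_i>\pi_{i+1}$. A hook of $\pi$ is determined by two points $(i,\pi_i)$ (its southwest endpoint) and $(j,\pi_j)$ (its northeast endpoint) with $i<j$ and $\pi_i<\pi_j$. $\mathrm{SW}_i(\pi)$ is the set of hooks of $\pi$ with southwest endpoint $(i,\pi_i)$. If $d_1<\cdots<d_k$ ($k\ge1$)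 are the descents of $\pi$, the rightmost ascending run of the plot is the sequence of points $(d_k+1,\pi_{d_k+1}),\ldots,(n,\pi_n)$. A descent $d$ is right-bound if every hook in $\mathrm{SW}_d(\pi)$ has its northeast endpoint in the rightmost ascending run. For a hook $H$ with southwest endpoint $(i,\pi_i)$ and northeast endpoint $(j,\pi_j)$, set $\pi_U^H=\pi_1\cdots\pi_i\pi_{j+1}\cdots\pi_n$ and $\pi_S^H=\pi_{i+1}\cdots\pi_{j-1}$. *)

theory Defs
  imports Complex_Main "HOL-Library.Tree" "HOL-Library.Poly_Mapping"
begin

text \<open>
  A colored binary plane tree over the colors \<open>'c\<close> is a \<open>'c tree\<close>: the empty tree is
  \<open>Leaf\<close>, and the vertices are the \<open>Node\<close>s.  A vertex is identified with the path leading to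
  it from the root (\<open>[]\<close> is the root), so that distinct vertices with equal colors stay distinct.
\<close>

datatype step = LC | RC

fun vertices :: "'a tree \<Rightarrow> step list set" where
  "vertices Leaf = {}"
| "vertices (Node l a r) = {[]} \<union> (Cons LC ` vertices l) \<union> (Cons RC ` vertices r)"

fun subtree_at :: "'a tree \<Rightarrow> step list \<Rightarrow> 'a tree" where
  "subtree_at t [] = t"
| "subtree_at Leaf (s # v) = Leaf"
| "subtree_at (Node l a r) (LC # v) = subtree_at l v"
| "subtree_at (Node l a r) (RC # v) = subtree_at r v"

fun replace_at :: "'a tree \<Rightarrow> step list \<Rightarrow> 'a tree \<Rightarrow> 'a tree" where
  "replace_at t [] s = s"
| "replace_at Leaf (c # v) s = Leaf"
| "replace_at (Node l a r) (LC # v) s = Node (replace_at l v s) a r"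
| "replace_at (Node l a r) (RC # v) s = Node l a (replace_at r v s)"

definition vertex_value :: "'a tree \<Rightarrow> step list \<Rightarrow> 'a" where
  "vertex_value t v = value (subtree_at t v)"

definition has_two_children :: "'a tree \<Rightarrow> step list \<Rightarrow> bool" where
  "has_two_children t v \<longleftrightarrow> left (subtree_at t v) \<noteq> Leaf \<and> right (subtree_at t v) \<noteq> Leaf"

text \<open>The color called black is an explicit parameter \<open>b\<close> of the following notions.\<close>

definition insertion :: "'c \<Rightarrow> step list \<Rightarrow> 'c tree \<Rightarrow> 'c tree \<Rightarrow> 'c tree" where
  "insertion b v T1 T2 = replace_at T1 v (Node (subtree_at T1 v) b T2)"

text \<open>
  Deleting the right subtree of \<open>v\<close> and contracting the left edge below \<open>v\<close> onto the left child
  puts the left subtree of \<open>v\<close> in the place of \<open>v\<close>.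
\<close>

definition decomposition :: "step list \<Rightarrow> 'c tree \<Rightarrow> 'c tree \<times> 'c tree" where
  "decomposition v T = (replace_at T v (left (subtree_at T v)), right (subtree_at T v))"

definition troupe :: "'c \<Rightarrow> 'c tree set \<Rightarrow> bool" where
  "troupe b TT \<longleftrightarrow>
     (\<forall>T1\<in>TT. \<forall>T2\<in>TT. T1 \<noteq> Leaf \<longrightarrow> T2 \<noteq> Leaf \<longrightarrow>
        (\<forall>v\<in>vertices T1. insertion b v T1 T2 \<in> TT)) \<and>
     (\<forall>T\<in>TT. \<forall>v\<in>vertices T. has_two_children T v \<longrightarrow> vertex_value T v = b \<longrightarrow>
        decomposition v T \<in> TT \<times> TT) \<and>
     (\<forall>T\<in>TT. \<forall>v\<in>vertices T. has_two_children T v \<longrightarrow> vertex_value T v = b)"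

definition insertion_additive :: "'c \<Rightarrow> ('c tree \<Rightarrow> complex) \<Rightarrow> bool" where
  "insertion_additive b f \<longleftrightarrow>
     (\<forall>T1 T2. T1 \<noteq> Leaf \<longrightarrow> T2 \<noteq> Leaf \<longrightarrow>
        (\<forall>v\<in>vertices T1. f (insertion b v T1 T2) = f T1 + f T2))"

text \<open>
  The sums live in the monoid ring over the integers of the commutative monoid of monomials: a
  monomial is a finitely supported map from variable indices to complex exponents, and the
  product of monomials adds the exponents.
\<close>

type_synonym genpoly = "(nat \<Rightarrow>\<^sub>0 complex) \<Rightarrow>\<^sub>0 int"

definition var_power :: "nat \<Rightarrow> complex \<Rightarrow> genpoly" where
  "var_power i a = Poly_Mapping.single (Poly_Mapping.single i a) 1"

lemma var_power_add: "var_power i a * var_power i b = var_power i (a + b)"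
  by (simp add: var_power_def mult_single single_add)

text \<open>A vertex of a labeled colored tree carries the pair of its color and its label.\<close>

type_synonym 'c labeled_tree = "('c \<times> nat) tree"

definition skel :: "'c labeled_tree \<Rightarrow> 'c tree" where
  "skel \<T> = map_tree fst \<T>"

definition label :: "'c labeled_tree \<Rightarrow> step list \<Rightarrow> nat" where
  "label \<T> v = snd (vertex_value \<T> v)"

text \<open>The parent of a nonroot vertex \<open>v\<close> is \<open>butlast v\<close>.\<close>

definition decreasing_tree :: "'c labeled_tree \<Rightarrow> bool" where
  "decreasing_tree \<T> \<longleftrightarrow>
     inj_on (label \<T>) (vertices \<T>) \<and>
     (\<forall>v\<in>vertices \<T>. 0 < label \<T> v) \<and>
     (\<forall>v\<in>vertices \<T>. v \<noteq> [] \<longrightarrow> label \<T> v < label \<T> (butlast v))"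

definition decreasing_trees :: "'c tree set \<Rightarrow> 'c labeled_tree set" where
  "decreasing_trees TT = {\<T>. decreasing_tree \<T> \<and> skel \<T> \<in> TT}"

definition ddot :: "('c tree \<Rightarrow> complex) \<Rightarrow> 'c labeled_tree \<Rightarrow> complex" where
  "ddot f \<T> = f (skel \<T>)"

definition postorder_reading :: "'c labeled_tree \<Rightarrow> nat list" where
  "postorder_reading \<T> = map snd (postorder \<T>)"

definition postorder_fiber :: "nat list \<Rightarrow> 'c labeled_tree set" where
  "postorder_fiber \<pi> = {\<T>. postorder_reading \<T> = \<pi>}"

text \<open>
  The colors form a finite type, so the fibers are finite and sums over subsets of them are
  genuine sums.
\<close>

lemma finite_postorder_fiber: "finite (postorder_fiber \<pi> :: ('c::finite) labeled_tree set)"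
proof -
  have fin: "finite {t::'a tree. size t \<le> n \<and> set_tree t \<subseteq> A}" if "finite A" for n and A :: "'a set"
  proof (induction n)
    case 0
    have "{t::'a tree. size t \<le> 0 \<and> set_tree t \<subseteq> A} \<subseteq> {Leaf}" by auto
    then show ?case by (rule finite_subset) simp
  next
    case (Suc n)
    let ?S = "{t::'a tree. size t \<le> n \<and> set_tree t \<subseteq> A}"
    have "{t::'a tree. size t \<le> Suc n \<and> set_tree t \<subseteq> A}
            \<subseteq> insert Leaf ((\<lambda>(l, a, r). Node l a r) ` (?S \<times> A \<times> ?S))"
    proof
      fix t assume t: "t \<in> {t::'a tree. size t \<le> Suc n \<and> set_tree t \<subseteq> A}"
      show "t \<in> insert Leaf ((\<lambda>(l, a, r). Node l a r) ` (?S \<times> A \<times> ?S))"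
        using t by (cases t) (auto simp: image_iff)
    qed
    then show ?case
      by (rule finite_subset) (intro finite.insertI finite_imageI finite_cartesian_product Suc that)
  qed
  have "(postorder_fiber \<pi> :: 'c labeled_tree set)
          \<subseteq> {t. size t \<le> length \<pi> \<and> set_tree t \<subseteq> UNIV \<times> set \<pi>}"
    by (force simp: postorder_fiber_def postorder_reading_def simp flip: set_postorder)
  then show ?thesis
    by (rule finite_subset) (intro fin finite_cartesian_product, simp_all)
qed

text \<open>A permutation is the list of its entries; positions are counted from 1.\<close>

definition permutation :: "nat list \<Rightarrow> bool" where
  "permutation \<pi> \<longleftrightarrow> distinct \<pi> \<and> (\<forall>m\<in>set \<pi>. 0 < m)"

definition entry :: "nat list \<Rightarrow> nat \<Rightarrow> nat" where
  "entry \<pi> i = \<pi> ! (i - 1)"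

definition descents :: "nat list \<Rightarrow> nat set" where
  "descents \<pi> = {i. 1 \<le> i \<and> i < length \<pi> \<and> entry \<pi> i > entry \<pi> (i + 1)}"

text \<open>A hook is recorded by the positions of its southwest and northeast endpoints.\<close>

definition hooks :: "nat list \<Rightarrow> (nat \<times> nat) set" where
  "hooks \<pi> = {(i, j). 1 \<le> i \<and> i < j \<and> j \<le> length \<pi> \<and> entry \<pi> i < entry \<pi> j}"

definition SW :: "nat list \<Rightarrow> nat \<Rightarrow> (nat \<times> nat) set" where
  "SW \<pi> i = {H \<in> hooks \<pi>. fst H = i}"

lemma finite_SW: "finite (SW \<pi> i)"
  by (rule finite_subset[of _ "{..length \<pi>} \<times> {..length \<pi>}"]) (auto simp: SW_def hooks_def)

text \<open>The positions of the points of the rightmost ascending run; used only if there are descents.\<close>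

definition rightmost_ascending_run :: "nat list \<Rightarrow> nat set" where
  "rightmost_ascending_run \<pi> = {Max (descents \<pi>) + 1 .. length \<pi>}"

definition right_bound_descent :: "nat list \<Rightarrow> nat \<Rightarrow> bool" where
  "right_bound_descent \<pi> d \<longleftrightarrow>
     d \<in> descents \<pi> \<and> (\<forall>H\<in>SW \<pi> d. snd H \<in> rightmost_ascending_run \<pi>)"

definition unsheltered :: "nat list \<Rightarrow> nat \<times> nat \<Rightarrow> nat list" where
  "unsheltered \<pi> H = take (fst H) \<pi> @ drop (snd H) \<pi>"

definition sheltered :: "nat list \<Rightarrow> nat \<times> nat \<Rightarrow> nat list" where
  "sheltered \<pi> H = drop (fst H) (take (snd H - 1) \<pi>)"

end

theory Submission
  imports Defs
begin

text \<open>
  Insertion is a weight-preserving bijection from the triples \<open>(H, U, S)\<close> on the right-hand side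
  onto the trees on the left-hand side.

  Let \<open>T\<close> be a decreasing tree with postorder reading \<open>\<pi>\<close>, and let \<open>u\<close> be its vertex labeled
  \<open>\<pi>\<^sub>d\<close>.  In postorder a vertex that is a right child or an only child is followed immediately by its
  parent, whose label is larger.  As \<open>d\<close> is a descent, \<open>u\<close> must be the left child of a vertex
  \<open>v\<close> that also has a right subtree \<open>S\<close> (lemma \<open>descent_vertex\<close>).  If \<open>v\<close> is labeled
  \<open>\<pi>\<^sub>j\<close>, then \<open>\<pi>\<^sub>d < \<pi>\<^sub>j\<close>, so \<open>H = (d, j)\<close> is a hook.  In a troupe \<open>v\<close> is black, so \<open>T\<close>
  may be decomposed at \<open>v\<close>: the postorder of \<open>S\<close> is the part of \<open>\<pi>\<close> strictly between positions
  \<open>d\<close> and \<open>j\<close>, and the other component \<open>U\<close> reads what remains after dropping \<open>\<pi>\<^sub>j\<close> as well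
  (lemma \<open>ex_labeled_insertion\<close>).

  Conversely, given \<open>H\<close>, \<open>U\<close> and \<open>S\<close>, insert \<open>S\<close> into \<open>U\<close> at the vertex in position \<open>d\<close> and
  label the new vertex \<open>\<pi>\<^sub>j\<close>.  The reading of the result is always \<open>\<pi>\<close>, but the result is decreasing
  only if \<open>\<pi>\<^sub>j\<close> exceeds the root label \<open>\<pi>\<^sub>j\<^sub>-\<^sub>1\<close> of \<open>S\<close> and lies below the labels of the new vertex's
  ancestors, which occur to the right of position \<open>j\<close>.  This is what right-boundness provides
  (lemmas \<open>right_bound_hook\<close> and \<open>labeled_insertion_in_fiber\<close>).

  A vertex of a tree is determined by its position in postorder, and insertion keeps the position
  \<open>d\<close> of the vertex at which it takes place.  Hence the point of insertion can be recovered from the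
  result, and decomposing there undoes the insertion (lemma \<open>labeled_insertion_inject\<close>).
  Insertion-additivity turns the weight of the result into the product of the weights of \<open>U\<close>
  and \<open>S\<close>.
\<close>

section \<open>Vertices and positions in postorder\<close>

lemma vertices_iff_subtree_at: "p \<in> vertices t \<longleftrightarrow> subtree_at t p \<noteq> Leaf"
proof (induction t arbitrary: p)
  case Leaf
  show ?case by (cases p) auto
next
  case (Node l a r)
  show ?case
  proof (cases p)
    case (Cons s q)
    then show ?thesis using Node by (cases s) auto
  qed simp
qed

lemma replace_at_subtree_at: "replace_at t p (subtree_at t p) = t"
  by (induction t p rule: subtree_at.induct) auto

lemma replace_at_replace_at: "replace_at (replace_at t p s) p s' = replace_at t p s'"
  by (induction t p s rule: replace_at.induct) auto

lemma subtree_at_replace_at: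
  "p \<in> vertices t \<Longrightarrow> subtree_at (replace_at t p s) p = s"
  by (induction t p s rule: replace_at.induct) auto

lemma subtree_at_append: "subtree_at t (p @ q) = subtree_at (subtree_at t p) q"
proof (induction t p rule: subtree_at.induct)
  case (2 s v)
  show ?case by (cases q) auto
qed auto

lemma decomposition_insertion:
  assumes "p \<in> vertices t"
  shows "decomposition p (insertion x p t s) = (t, s)"
  by (simp add: decomposition_def insertion_def subtree_at_replace_at[OF assms]
      replace_at_replace_at replace_at_subtree_at)

text \<open>
  The part of the postorder before and after the subtree at a vertex depends only on the
  surroundings of that subtree; so replacing the subtree acts on the postorder as a substitution of
  a contiguous block.
\<close>

fun before :: "'a tree \<Rightarrow> step list \<Rightarrow> 'a list" where
  "before t [] = []"
| "before Leaf (s # p) = []"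
| "before (Node l a r) (LC # p) = before l p"
| "before (Node l a r) (RC # p) = postorder l @ before r p"

fun after :: "'a tree \<Rightarrow> step list \<Rightarrow> 'a list" where
  "after t [] = []"
| "after Leaf (s # p) = []"
| "after (Node l a r) (LC # p) = after l p @ postorder r @ [a]"
| "after (Node l a r) (RC # p) = after r p @ [a]"

lemma postorder_replace_at:
  "p \<in> vertices t \<Longrightarrow> postorder (replace_at t p s) = before t p @ postorder s @ after t p"
  by (induction t p s rule: replace_at.induct) auto

lemma postorder_around_subtree_at:
  "p \<in> vertices t \<Longrightarrow> postorder t = before t p @ postorder (subtree_at t p) @ after t p"
  using postorder_replace_at[of p t "subtree_at t p"] by (simp add: replace_at_subtree_at)

lemma before_replace_at: "before (replace_at t p s) p = before t p"
  by (induction t p s rule: replace_at.induct) auto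

lemma before_snoc_LC: "before t (p @ [LC]) = before t p"
proof (induction t p rule: before.induct)
  case (1 t)
  show ?case by (cases t) auto
qed auto

text \<open>
  The root of a subtree is the last of its vertices in postorder; so this is the position,
  counted from 1, of the vertex \<open>p\<close> itself.
\<close>

definition position :: "'a tree \<Rightarrow> step list \<Rightarrow> nat" where
  "position t p = length (before t p) + size (subtree_at t p)"

lemma position_le_size: "p \<in> vertices t \<Longrightarrow> position t p \<le> size t"
  using arg_cong[OF postorder_around_subtree_at[of p t], of length]
  by (simp add: position_def)

lemma position_Node [simp]:
  "position (Node l a r) [] = Suc (size l + size r)"
  "position (Node l a r) (LC # p) = position l p"
  "position (Node l a r) (RC # p) = size l + position r p"
  by (simp_all add: position_def)

lemma position_pos: "p \<in> vertices t \<Longrightarrow> 0 < position t p"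
  by (cases "subtree_at t p") (auto simp: position_def vertices_iff_subtree_at)

text \<open>
  Postorder lists the left subtree in positions \<open>1\<close> to \<open>size l\<close>, the right subtree in the
  following \<open>size r\<close> positions, and the root last; these ranges are disjoint.
\<close>

lemma inj_on_position: "inj_on (position t) (vertices t)"
proof (induction t)
  case (Node l a r)
  have bl: "position l p \<le> size l" if "p \<in> vertices l" for p
    using that by (rule position_le_size)
  have br: "0 < position r p" "position r p \<le> size r" if "p \<in> vertices r" for p
    using position_pos[OF that] position_le_size[OF that] .
  have inj_l: "p = q" if "p \<in> vertices l" "q \<in> vertices l" "position l p = position l q" for p q
    using Node.IH(1) that by (auto dest: inj_onD)
  have inj_r: "p = q" if "p \<in> vertices r" "q \<in> vertices r" "position r p = position r q" for p q
    using Node.IH(2) that by (auto dest: inj_onD)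
  have cross: "position l p \<noteq> size l + position r q" if "p \<in> vertices l" "q \<in> vertices r" for p q
    using bl[OF that(1)] br(1)[OF that(2)] by linarith
  have root: "position l p \<noteq> Suc (size l + size r)" if "p \<in> vertices l" for p
    using bl[OF that] by linarith
  have root': "position r p \<noteq> Suc (size r)" if "p \<in> vertices r" for p
    using br(2)[OF that] by linarith
  show ?case
    by (rule inj_onI)
       (auto simp: cross cross[symmetric] root root' root[symmetric] root'[symmetric]
         intro: inj_l inj_r)
qed simp

lemma ex_vertex_at_position:
  "0 < d \<Longrightarrow> d \<le> size t \<Longrightarrow> \<exists>p\<in>vertices t. position t p = d"
proof (induction t arbitrary: d)
  case (Node l a r)
  consider "d \<le> size l" | "size l < d" "d \<le> size l + size r" | "d = Suc (size l + size r)"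
    using Node.prems by fastforce
  then show ?case
  proof cases
    case 1
    then obtain p where "p \<in> vertices l" "position l p = d" using Node by blast
    then show ?thesis by (intro bexI[of _ "LC # p"]) auto
  next
    case 2
    then obtain p where "p \<in> vertices r" "position r p = d - size l"
      using Node.IH(2)[of "d - size l"] by fastforce
    then show ?thesis using 2 by (intro bexI[of _ "RC # p"]) auto
  next
    case 3
    then show ?thesis by (intro bexI[of _ "[]"]) auto
  qed
qed simp

definition vertex_at :: "'a tree \<Rightarrow> nat \<Rightarrow> step list" where
  "vertex_at t d = (THE p. p \<in> vertices t \<and> position t p = d)"

lemma vertex_at_eqI: "p \<in> vertices t \<Longrightarrow> position t p = d \<Longrightarrow> vertex_at t d = p"
  unfolding vertex_at_def by (rule the_equality) (auto dest: inj_onD[OF inj_on_position])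

lemma vertex_at:
  assumes "0 < d" "d \<le> size t"
  shows "vertex_at t d \<in> vertices t" "position t (vertex_at t d) = d"
proof -
  obtain p where "p \<in> vertices t" "position t p = d"
    using ex_vertex_at_position[OF assms] by blast
  moreover from this have "vertex_at t d = p" by (rule vertex_at_eqI)
  ultimately show "vertex_at t d \<in> vertices t" "position t (vertex_at t d) = d"
    by simp_all
qed

lemma last_postorder: "t \<noteq> Leaf \<Longrightarrow> last (postorder t) = value t"
  by (cases t) auto

lemma postorder_eq_Nil_iff: "postorder t = [] \<longleftrightarrow> t = Leaf"
  by (cases t) auto

section \<open>Skeletons and the heap order\<close>

lemma vertices_map_tree: "vertices (map_tree g t) = vertices t"
  by (induction t) auto

lemma subtree_at_map_tree: "subtree_at (map_tree g t) p = map_tree g (subtree_at t p)"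
  by (induction t p rule: subtree_at.induct) auto

lemma replace_at_map_tree:
  "replace_at (map_tree g t) p (map_tree g s) = map_tree g (replace_at t p s)"
  by (induction t p s rule: replace_at.induct) auto

lemma skel_insertion: "skel (insertion x p t s) = insertion (fst x) p (skel t) (skel s)"
  by (simp add: skel_def insertion_def subtree_at_map_tree flip: replace_at_map_tree)

lemma vertices_skel: "vertices (skel t) = vertices t"
  by (simp add: skel_def vertices_map_tree)

lemma skel_eq_Leaf_iff: "skel t = Leaf \<longleftrightarrow> t = Leaf"
  by (cases t) (auto simp: skel_def)

text \<open>
  Comparing a vertex with all its descendants rather than just its children makes the order condition
  recursive in the tree and lets it be read off sets of labels.
\<close>

fun heap_ordered :: "'c labeled_tree \<Rightarrow> bool" where
  "heap_ordered Leaf \<longleftrightarrow> True"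
| "heap_ordered (Node l a r) \<longleftrightarrow>
     heap_ordered l \<and> heap_ordered r \<and> (\<forall>x\<in>set_tree l \<union> set_tree r. snd x < snd a)"

lemma heap_ordered_le_root: "heap_ordered t \<Longrightarrow> x \<in> set_tree t \<Longrightarrow> snd x \<le> snd (value t)"
  by (cases t) (auto intro: less_imp_le)

lemma label_Node [simp]:
  "label (Node l a r) [] = snd a"
  "label (Node l a r) (LC # p) = label l p"
  "label (Node l a r) (RC # p) = label r p"
  by (simp_all add: label_def vertex_value_def)

lemma heap_ordered_iff_parents:
  "heap_ordered t \<longleftrightarrow> (\<forall>v\<in>vertices t. v \<noteq> [] \<longrightarrow> label t v < label t (butlast v))"
proof (induction t)
  case (Node l a r)
  have root: "(\<forall>x\<in>set_tree s. snd x < snd a) \<longleftrightarrow> (s \<noteq> Leaf \<longrightarrow> label s [] < snd a)"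
    if "heap_ordered s" for s
  proof (cases s)
    case (Node l' a' r')
    then show ?thesis
      using heap_ordered_le_root[OF that] by (auto intro: le_less_trans)
  qed simp
  \<comment> \<open>The parent of the root of a subtree \<open>s\<close> is the vertex labeled \<open>a\<close>; all other vertices of
    \<open>s\<close> keep their parent.\<close>
  have child: "(\<forall>v\<in>vertices s. label s v < (if v = [] then snd a else label s (butlast v)))
      \<longleftrightarrow> (s \<noteq> Leaf \<longrightarrow> label s [] < snd a) \<and>
        (\<forall>v\<in>vertices s. v \<noteq> [] \<longrightarrow> label s v < label s (butlast v))" for s
    by (cases s) auto
  have "heap_ordered (Node l a r) \<longleftrightarrow>
      (\<forall>v\<in>vertices l. label l v < (if v = [] then snd a else label l (butlast v))) \<and>
      (\<forall>v\<in>vertices r. label r v < (if v = [] then snd a else label r (butlast v)))"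
    unfolding child heap_ordered.simps ball_Un
    unfolding Node.IH[symmetric] using root[of l] root[of r] by blast
  also have "\<dots> \<longleftrightarrow> (\<forall>v\<in>vertices (Node l a r). v \<noteq> [] \<longrightarrow>
      label (Node l a r) v < label (Node l a r) (butlast v))"
    by (auto simp: ball_Un split: if_splits)
  finally show ?case .
qed simp

lemma label_image_vertices: "label t ` vertices t = set (postorder_reading t)"
  by (induction t) (auto simp: postorder_reading_def image_Un image_image)

lemma inj_on_label: "distinct (postorder_reading t) \<Longrightarrow> inj_on (label t) (vertices t)"
proof (induction t)
  case (Node l a r)
  have "distinct (postorder_reading l)" "distinct (postorder_reading r)"
    and disj: "label l ` vertices l \<inter> label r ` vertices r = {}"
      "snd a \<notin> label l ` vertices l" "snd a \<notin> label r ` vertices r"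
    using Node.prems unfolding label_image_vertices by (auto simp: postorder_reading_def)
  then have inj: "inj_on (label l) (vertices l)" "inj_on (label r) (vertices r)"
    using Node.IH by simp_all
  have cross: "label l p \<noteq> label r q" if "p \<in> vertices l" "q \<in> vertices r" for p q
    using disj(1) that by blast
  have root: "label l p \<noteq> snd a" if "p \<in> vertices l" for p
    using disj(2) that by (metis image_eqI)
  have root': "label r p \<noteq> snd a" if "p \<in> vertices r" for p
    using disj(3) that by (metis image_eqI)
  show ?case
    by (rule inj_onI)
       (auto simp: cross cross[symmetric] root root' root[symmetric] root'[symmetric]
         intro: inj_onD[OF inj(1)] inj_onD[OF inj(2)])
qed simp

text \<open>
  The labels of a tree are the entries of its reading, so for a fixed permutation as reading only the
  order condition is left to check.
\<close>

lemma decreasing_tree_iff_heap_ordered: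
  assumes "permutation (postorder_reading t)"
  shows "decreasing_tree t \<longleftrightarrow> heap_ordered t"
proof -
  have "inj_on (label t) (vertices t)"
    using assms by (intro inj_on_label) (simp add: permutation_def)
  moreover have "\<forall>v\<in>vertices t. 0 < label t v"
    using assms by (auto simp: permutation_def simp flip: label_image_vertices)
  ultimately show ?thesis
    by (simp add: decreasing_tree_def heap_ordered_iff_parents)
qed

lemma heap_ordered_subtree_at: "heap_ordered t \<Longrightarrow> heap_ordered (subtree_at t p)"
  by (induction t p rule: subtree_at.induct) auto

lemma set_tree_replace_at_subset:
  "set_tree (replace_at t p s) \<subseteq> set_tree t \<union> set_tree s"
  by (induction t p s rule: replace_at.induct) auto

text \<open>
  Ancestors come later in postorder than their descendants.  It is therefore enough that the new
  labels are smaller than everything that is read after them.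
\<close>

lemma heap_ordered_replace_at_if_less_after:
  assumes "heap_ordered t" "heap_ordered s"
    "\<forall>x\<in>set_tree s. \<forall>y\<in>set (after t p). snd x < snd y"
  shows "heap_ordered (replace_at t p s)"
  using assms
proof (induction t p s rule: replace_at.induct)
  case (3 l a r v s)
  have after: "set (after (Node l a r) (LC # v)) = insert a (set (after l v) \<union> set_tree r)"
    by simp
  have "heap_ordered l" "\<forall>x\<in>set_tree s. \<forall>y\<in>set (after l v). snd x < snd y"
    using "3.prems"(1,3) unfolding after heap_ordered.simps by blast+
  then have "heap_ordered (replace_at l v s)"
    using "3.IH" "3.prems"(2) by blast
  moreover have "\<forall>x\<in>set_tree (replace_at l v s). snd x < snd a"
    using "3.prems"(1,3) set_tree_replace_at_subset[of l v s]
    unfolding after heap_ordered.simps by blast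
  ultimately show ?case
    using "3.prems"(1) unfolding heap_ordered.simps replace_at.simps by blast
next
  case (4 l a r v s)
  have after: "set (after (Node l a r) (RC # v)) = insert a (set (after r v))"
    by simp
  have "heap_ordered r" "\<forall>x\<in>set_tree s. \<forall>y\<in>set (after r v). snd x < snd y"
    using "4.prems"(1,3) unfolding after heap_ordered.simps by blast+
  then have "heap_ordered (replace_at r v s)"
    using "4.IH" "4.prems"(2) by blast
  moreover have "\<forall>x\<in>set_tree (replace_at r v s). snd x < snd a"
    using "4.prems"(1,3) set_tree_replace_at_subset[of r v s]
    unfolding after heap_ordered.simps by blast
  ultimately show ?case
    using "4.prems"(1) unfolding heap_ordered.simps replace_at.simps by blast
qed simp_all

lemma set_tree_subtree_at: "set_tree (subtree_at t p) \<subseteq> set_tree t"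
  by (induction t p rule: subtree_at.induct) auto

text \<open>
  Labels that were already below the ancestors of \<open>p\<close> remain below them.
\<close>

lemma heap_ordered_replace_at_if_subset:
  assumes "heap_ordered t" "heap_ordered s" "set_tree s \<subseteq> set_tree (subtree_at t p)"
  shows "heap_ordered (replace_at t p s)"
  using assms
proof (induction t p s rule: replace_at.induct)
  case (3 l a r v s)
  have "set_tree (replace_at l v s) \<subseteq> set_tree l"
    using "3.prems"(3) set_tree_replace_at_subset[of l v s] set_tree_subtree_at[of l v]
    by auto
  moreover have "heap_ordered (replace_at l v s)"
    using 3 by simp
  ultimately show ?case
    using "3.prems"(1) unfolding heap_ordered.simps replace_at.simps by blast
next
  case (4 l a r v s)
  have "set_tree (replace_at r v s) \<subseteq> set_tree r"
    using "4.prems"(3) set_tree_replace_at_subset[of r v s] set_tree_subtree_at[of r v]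
    by auto
  moreover have "heap_ordered (replace_at r v s)"
    using 4 by simp
  ultimately show ?case
    using "4.prems"(1) unfolding heap_ordered.simps replace_at.simps by blast
qed simp_all

section \<open>Descents and hooks\<close>

text \<open>
  A descent either lies within the left or the right subtree, where induction applies, or it
  involves two of the three parts of the reading.  As the root carries the largest label, the
  second kind is possible only between the last entry of the left subtree (its root) and the first
  entry of the right subtree, both of which must then be nonempty.  The index \<open>i\<close> counts from 0, positions
  count from 1.
\<close>

lemma descent_vertex:
  assumes "heap_ordered t" "Suc i < size t"
    "postorder_reading t ! Suc i < postorder_reading t ! i"
  shows "\<exists>p l x r. subtree_at t p = Node l x r \<and> l \<noteq> Leaf \<and> r \<noteq> Leaf \<and>
    length (before t p) + size l = Suc i"
  using assms
proof (induction t arbitrary: i)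
  case (Node l a r)
  let ?w = "postorder_reading (Node l a r)"
  have w: "?w = postorder_reading l @ postorder_reading r @ [snd a]"
    by (simp add: postorder_reading_def)
  have h: "heap_ordered l" "heap_ordered r"
    using Node.prems(1) by simp_all
  have len: "length (postorder_reading s) = size s" for s :: "'a labeled_tree"
    by (simp add: postorder_reading_def)
  \<comment> \<open>The root is never the bottom of a descent.\<close>
  have "Suc i \<noteq> size l + size r"
  proof
    assume i: "Suc i = size l + size r"
    then have "?w ! i \<in> set (postorder_reading l @ postorder_reading r)"
      unfolding w by (auto simp: nth_append len in_set_conv_nth)
    then obtain y where "y \<in> set_tree l \<union> set_tree r" "?w ! i = snd y"
      by (auto simp: postorder_reading_def)
    then have "?w ! i < snd a" using Node.prems(1) by simp
    moreover have "?w ! Suc i = snd a"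
      unfolding w i by (simp add: nth_append len)
    ultimately show False using Node.prems(3) by simp
  qed
  then consider "Suc i < size l" | "Suc i = size l" "r \<noteq> Leaf"
    | "size l \<le> i" "Suc i < size l + size r"
    using Node.prems(2) by (cases "r = Leaf") (fastforce simp: eq_size_0)+
  then show ?case
  proof cases
    case 1
    then have "postorder_reading l ! Suc i < postorder_reading l ! i"
      using Node.prems(3) unfolding w by (simp add: nth_append len)
    then obtain p l' x r' where "subtree_at l p = Node l' x r'" "l' \<noteq> Leaf" "r' \<noteq> Leaf"
      "length (before l p) + size l' = Suc i"
      using Node.IH(1)[OF h(1) 1] by blast
    then show ?thesis by (intro exI[of _ "LC # p"]) auto
  next
    case 2
    then show ?thesis by (intro exI[of _ "[]"]) auto
  next
    case 3
    then have i: "Suc (i - size l) < size r" by linarith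
    have "?w ! i = postorder_reading r ! (i - size l)"
      "?w ! Suc i = postorder_reading r ! Suc (i - size l)"
      using 3 i unfolding w by (simp_all add: nth_append len Suc_diff_le)
    then have "postorder_reading r ! Suc (i - size l) < postorder_reading r ! (i - size l)"
      using Node.prems(3) by simp
    then obtain p l' x r' where "subtree_at r p = Node l' x r'" "l' \<noteq> Leaf" "r' \<noteq> Leaf"
      "length (before r p) + size l' = Suc (i - size l)"
      using Node.IH(2)[OF h(2) i] by blast
    then show ?thesis using 3 by (intro exI[of _ "RC # p"]) auto
  qed
qed simp

lemma finite_descents: "finite (descents \<pi>)"
  by (rule finite_subset[of _ "{..length \<pi>}"]) (auto simp: descents_def)

lemma entry_less_in_rightmost_ascending_run:
  assumes "permutation \<pi>" "descents \<pi> \<noteq> {}" "Max (descents \<pi>) < i" "i < j" "j \<le> length \<pi>"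
  shows "entry \<pi> i < entry \<pi> j"
proof -
  have ascent: "entry \<pi> k < entry \<pi> (Suc k)" if "i \<le> k" "k < length \<pi>" for k
  proof -
    have "k \<notin> descents \<pi>" using Max_ge[OF finite_descents[of \<pi>], of k] assms(3) that by auto
    then have "entry \<pi> k \<le> entry \<pi> (Suc k)"
      using that assms(3) by (auto simp: descents_def)
    moreover have "entry \<pi> k \<noteq> entry \<pi> (Suc k)"
      using assms(1,3) that by (auto simp: permutation_def entry_def nth_eq_iff_index_eq)
    ultimately show ?thesis by simp
  qed
  from \<open>i < j\<close> have "Suc i \<le> j" by simp
  then show ?thesis using assms(5)
  proof (induction j rule: dec_induct)
    case base
    then show ?case by (auto intro: ascent)
  next
    case (step n)
    have "entry \<pi> n < entry \<pi> (Suc n)" using step by (intro ascent) auto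
    with step show ?case by simp
  qed
qed

text \<open>
  These inequalities keep the tree decreasing after insertion of a vertex labeled \<open>\<pi>\<^sub>j\<close>.  The last
  one holds because \<open>j\<close> lies in the rightmost ascending run.  For the comparison with \<open>\<pi>\<^sub>j\<^sub>-\<^sub>1\<close>, the
  critical case is that \<open>j\<close> is the first position of that run: then \<open>\<pi>\<^sub>j\<^sub>-\<^sub>1 > \<pi>\<^sub>j > \<pi>\<^sub>d\<close>, so
  \<open>(d, j - 1)\<close> would be a hook ending outside the run, contrary to right-boundness.
\<close>

lemma right_bound_hook:
  assumes "permutation \<pi>" "right_bound_descent \<pi> d" "(d, j) \<in> SW \<pi> d"
  shows "Suc d < j" "entry \<pi> (j - 1) < entry \<pi> j"
    "\<And>k. j < k \<Longrightarrow> k \<le> length \<pi> \<Longrightarrow> entry \<pi> j < entry \<pi> k"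
proof -
  let ?M = "Max (descents \<pi>)"
  have d: "d \<in> descents \<pi>" and ne: "descents \<pi> \<noteq> {}"
    and rb: "\<And>k. (d, k) \<in> SW \<pi> d \<Longrightarrow> ?M < k"
    using assms(2) by (auto simp: right_bound_descent_def rightmost_ascending_run_def)
  have hook: "1 \<le> d" "d < j" "j \<le> length \<pi>" "entry \<pi> d < entry \<pi> j"
    using assms(3) by (auto simp: SW_def hooks_def)
  have "j \<noteq> Suc d" using d hook by (auto simp: descents_def)
  with hook show dj: "Suc d < j" by simp
  have Mj: "?M < j" using rb assms(3) .
  show "entry \<pi> j < entry \<pi> k" if "j < k" "k \<le> length \<pi>" for k
    using entry_less_in_rightmost_ascending_run[OF assms(1) ne Mj that] .
  show "entry \<pi> (j - 1) < entry \<pi> j"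
  proof (cases "?M = j - 1")
    case False
    then show ?thesis
      using Mj hook dj by (intro entry_less_in_rightmost_ascending_run[OF assms(1) ne]) auto
  next
    case True
    then have "j - 1 \<in> descents \<pi>" using Max_in[OF finite_descents ne] by simp
    then have "entry \<pi> j < entry \<pi> (j - 1)" using dj by (auto simp: descents_def)
    then have "(d, j - 1) \<in> SW \<pi> d" using hook dj by (auto simp: SW_def hooks_def)
    from rb[OF this] True show ?thesis by simp
  qed
qed

lemma permutation_unsheltered:
  assumes "permutation \<pi>" "fst H \<le> snd H"
  shows "permutation (unsheltered \<pi> H)"
  using assms set_take_disj_set_drop_if_distinct[of \<pi> "fst H" "snd H"]
  by (auto simp: permutation_def unsheltered_def dest: in_set_takeD in_set_dropD)

lemma permutation_sheltered:
  assumes "permutation \<pi>"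
  shows "permutation (sheltered \<pi> H)"
  using assms by (auto simp: permutation_def sheltered_def dest: in_set_takeD in_set_dropD)

lemma list_split_at_hook:
  assumes "d < j" "j \<le> length \<pi>"
  shows "take d \<pi> @ sheltered \<pi> (d, j) @ entry \<pi> j # drop j \<pi> = \<pi>"
proof -
  have "take d \<pi> @ sheltered \<pi> (d, j) = take (j - 1) \<pi>"
    using assms append_take_drop_id[of d "take (j - 1) \<pi>"]
    by (simp add: sheltered_def min_def split: if_splits)
  moreover have "entry \<pi> j # drop j \<pi> = drop (j - 1) \<pi>"
    using assms by (cases j) (auto simp: entry_def Cons_nth_drop_Suc)
  ultimately show ?thesis by (metis append_assoc append_take_drop_id)
qed

section \<open>Insertion and decomposition at a right-bound descent\<close>

text \<open>
  The color and the label of the new vertex form the vertex value of a labeled tree; so insertion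
  of unlabeled trees can be used with this pair as its color.
\<close>

definition labeled_insertion ::
  "'c \<Rightarrow> nat list \<Rightarrow> nat \<times> nat \<Rightarrow> 'c labeled_tree \<Rightarrow> 'c labeled_tree \<Rightarrow> 'c labeled_tree" where
  "labeled_insertion b \<pi> H U S = insertion (b, entry \<pi> (snd H)) (vertex_at U (fst H)) U S"

lemma vertex_at_unsheltered:
  assumes "(d, j) \<in> SW \<pi> d" "U \<in> postorder_fiber (unsheltered \<pi> (d, j))"
  shows "vertex_at U d \<in> vertices U" "position U (vertex_at U d) = d"
proof -
  have "postorder_reading U = unsheltered \<pi> (d, j)"
    using assms(2) by (simp add: postorder_fiber_def)
  then have "size U = length (unsheltered \<pi> (d, j))"
    by (metis length_map length_postorder postorder_reading_def)
  then have "d \<le> size U" "0 < d"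
    using assms(1) by (auto simp: unsheltered_def SW_def hooks_def)
  then show "vertex_at U d \<in> vertices U" "position U (vertex_at U d) = d"
    using vertex_at by blast+
qed

text \<open>
  After insertion the old vertex sits one left step below \<open>p\<close>.  All new vertices are read after
  it, so its position does not change.
\<close>

lemma position_insertion_snoc_LC:
  assumes "p \<in> vertices t"
  shows "p @ [LC] \<in> vertices (insertion x p t s)"
    "position (insertion x p t s) (p @ [LC]) = position t p"
  using assms
  by (simp_all add: position_def vertices_iff_subtree_at before_snoc_LC subtree_at_append
      insertion_def before_replace_at subtree_at_replace_at)

text \<open>
  The subtree \<open>S\<close> is nonempty because \<open>\<pi>\<^sub>d\<^sub>+\<^sub>1 < \<pi>\<^sub>d < \<pi>\<^sub>j\<close> leaves at least one position between
  \<open>d\<close> and \<open>j\<close>.  This is needed both for closure of the troupe under insertion and for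
  insertion-additivity.
\<close>

lemma labeled_insertion_in_fiber:
  fixes TT :: "'c tree set"
  assumes "troupe b TT" "permutation \<pi>" "right_bound_descent \<pi> d" "(d, j) \<in> SW \<pi> d"
    and U: "U \<in> postorder_fiber (unsheltered \<pi> (d, j)) \<inter> decreasing_trees TT"
    and S: "S \<in> postorder_fiber (sheltered \<pi> (d, j)) \<inter> decreasing_trees TT"
  shows "S \<noteq> Leaf"
    and "labeled_insertion b \<pi> (d, j) U S \<in> postorder_fiber \<pi> \<inter> decreasing_trees TT"
proof -
  define p where "p = vertex_at U d"
  let ?x = "(b, entry \<pi> j)"
  let ?V = "subtree_at U p"
  let ?T = "insertion ?x p U S"
  note rb = right_bound_hook[OF assms(2-4)]
  have hook: "1 \<le> d" "d < j" "j \<le> length \<pi>" "entry \<pi> d < entry \<pi> j"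
    using assms(4) by (auto simp: SW_def hooks_def)
  have p: "p \<in> vertices U" "position U p = d"
    using vertex_at_unsheltered[OF assms(4)] U unfolding p_def by auto
  have V: "?V \<noteq> Leaf" using p(1) by (simp add: vertices_iff_subtree_at)
  have readU: "map snd (before U p @ postorder ?V) @ map snd (after U p) = take d \<pi> @ drop j \<pi>"
    using U postorder_around_subtree_at[OF p(1)]
    by (auto simp: postorder_fiber_def postorder_reading_def unsheltered_def)
  moreover have "length (map snd (before U p @ postorder ?V)) = length (take d \<pi>)"
    using p(2) hook by (simp add: position_def)
  ultimately have bU: "map snd (before U p @ postorder ?V) = take d \<pi>"
    and aU: "map snd (after U p) = drop j \<pi>"
    by (simp_all add: append_eq_append_conv del: map_append)
  have readS: "postorder_reading S = sheltered \<pi> (d, j)"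
    using S by (simp add: postorder_fiber_def)
  have lenS: "size S = j - 1 - d"
    using arg_cong[OF readS, of length] hook by (simp add: postorder_reading_def sheltered_def)
  then show SL: "S \<noteq> Leaf" using rb(1) by auto
  have readT: "postorder_reading ?T = \<pi>"
  proof -
    have "postorder_reading ?T = map snd (before U p @ postorder ?V) @ postorder_reading S
        @ entry \<pi> j # map snd (after U p)"
      by (simp add: postorder_reading_def insertion_def postorder_replace_at[OF p(1)])
    also have "\<dots> = \<pi>"
      unfolding bU aU readS using list_split_at_hook hook by simp
    finally show ?thesis .
  qed
  \<comment> \<open>The root of a subtree is read last, so its label is the last entry of the corresponding block
    and bounds all labels of the subtree.\<close>
  have rootV: "snd (value ?V) = entry \<pi> d"
  proof -
    have "snd (value ?V) = last (map snd (before U p @ postorder ?V))"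
      using V by (simp add: last_map postorder_eq_Nil_iff last_postorder)
    also have "\<dots> = entry \<pi> d"
      unfolding bU using hook by (subst last_conv_nth) (auto simp: entry_def min_def)
    finally show ?thesis .
  qed
  have rootS: "snd (value S) = entry \<pi> (j - 1)"
  proof -
    have "snd (value S) = last (sheltered \<pi> (d, j))"
      using SL by (simp add: last_map postorder_eq_Nil_iff last_postorder postorder_reading_def
          flip: readS)
    also have "\<dots> = entry \<pi> (j - 1)"
      using hook rb(1)
      by (subst last_conv_nth) (auto simp: entry_def min_def sheltered_def numeral_2_eq_2)
    finally show ?thesis .
  qed
  have "permutation (postorder_reading U)" "decreasing_tree U"
    using U permutation_unsheltered[OF assms(2), of "(d, j)"] hook
    by (simp_all add: postorder_fiber_def decreasing_trees_def)
  then have hU: "heap_ordered U" by (simp add: decreasing_tree_iff_heap_ordered)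
  have "permutation (postorder_reading S)" "decreasing_tree S"
    using S permutation_sheltered[OF assms(2), of "(d, j)"]
    by (simp_all add: postorder_fiber_def decreasing_trees_def)
  then have hS: "heap_ordered S" by (simp add: decreasing_tree_iff_heap_ordered)
  have ltV: "snd x < entry \<pi> j" if "x \<in> set_tree ?V" for x
    using heap_ordered_le_root[OF heap_ordered_subtree_at[OF hU] that] rootV hook by simp
  have ltS: "snd x < entry \<pi> j" if "x \<in> set_tree S" for x
    using heap_ordered_le_root[OF hS that] rootS rb(2) by simp
  have gt: "entry \<pi> j < snd y" if "y \<in> set (after U p)" for y
  proof -
    have "snd y \<in> set (drop j \<pi>)" using that by (auto simp flip: aU)
    then obtain k where "k < length (drop j \<pi>)" "snd y = drop j \<pi> ! k"
      by (metis in_set_conv_nth)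
    then show ?thesis using rb(3)[of "Suc (j + k)"] by (simp add: entry_def)
  qed
  have "heap_ordered ?T"
    unfolding insertion_def
    by (rule heap_ordered_replace_at_if_less_after[OF hU])
       (auto simp: hS heap_ordered_subtree_at[OF hU] dest: ltV ltS gt intro: less_trans)
  then have "decreasing_tree ?T"
    using decreasing_tree_iff_heap_ordered[of ?T] readT assms(2) by simp
  moreover have "skel ?T \<in> TT"
    using assms(1) U S p(1) SL V
    by (auto simp: troupe_def skel_insertion decreasing_trees_def skel_eq_Leaf_iff vertices_skel)
  ultimately show "labeled_insertion b \<pi> (d, j) U S \<in> postorder_fiber \<pi> \<inter> decreasing_trees TT"
    using readT by (simp add: labeled_insertion_def p_def postorder_fiber_def decreasing_trees_def)
qed

text \<open>
  Decomposition at the parent \<open>p\<close> of the vertex in position \<open>d\<close> is inverse to the insertion.  The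
  postorder of \<open>T\<close> passes through the left subtree \<open>l\<close> of \<open>p\<close>, ending in position \<open>d\<close>, then
  through the right subtree \<open>r\<close>, and reaches \<open>p\<close> in position \<open>d + size r + 1\<close>.
\<close>

lemma ex_labeled_insertion:
  fixes TT :: "'c tree set"
  assumes "troupe b TT" "permutation \<pi>" "d \<in> descents \<pi>"
    and T: "T \<in> postorder_fiber \<pi> \<inter> decreasing_trees TT"
  shows "\<exists>j U S. (d, j) \<in> SW \<pi> d \<and>
    U \<in> postorder_fiber (unsheltered \<pi> (d, j)) \<inter> decreasing_trees TT \<and>
    S \<in> postorder_fiber (sheltered \<pi> (d, j)) \<inter> decreasing_trees TT \<and>
    labeled_insertion b \<pi> (d, j) U S = T"
proof -
  have read: "postorder_reading T = \<pi>" and TT: "skel T \<in> TT"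
    using T by (auto simp: postorder_fiber_def decreasing_trees_def)
  have h: "heap_ordered T"
    using T assms(2) decreasing_tree_iff_heap_ordered[of T] read
    by (auto simp: decreasing_trees_def)
  have d: "1 \<le> d" "d < length \<pi>" "\<pi> ! d < \<pi> ! (d - 1)"
    using assms(3) by (auto simp: descents_def entry_def)
  have sizeT: "size T = length \<pi>"
    using arg_cong[OF read, of length] by (simp add: postorder_reading_def)
  obtain p l x r where sub: "subtree_at T p = Node l x r" and l: "l \<noteq> Leaf" and r: "r \<noteq> Leaf"
    and len: "length (before T p) + size l = d"
    using descent_vertex[OF h, of "d - 1"] d read sizeT by auto
  have p: "p \<in> vertices T" using sub by (simp add: vertices_iff_subtree_at)
  define j where "j = d + size r + 1"
  define U where "U = replace_at T p l"
  have pi: "\<pi> = map snd (before T p @ postorder l) @ postorder_reading r @ snd x # map snd (after T p)"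
    using postorder_around_subtree_at[OF p] sub by (simp add: postorder_reading_def flip: read)
  have lenr: "length (postorder_reading r) = size r" by (simp add: postorder_reading_def)
  have lend: "length (map snd (before T p @ postorder l)) = d" using len by simp
  have take: "take d \<pi> = map snd (before T p @ postorder l)"
    by (subst pi) (simp add: lend[symmetric] del: map_append)
  have drop: "drop d \<pi> = postorder_reading r @ snd x # map snd (after T p)"
    by (subst pi) (simp add: lend[symmetric] del: map_append)
  have "drop j \<pi> = drop (Suc (size r)) (drop d \<pi>)" by (simp add: j_def add.commute)
  then have dropj: "drop j \<pi> = map snd (after T p)" unfolding drop by (simp add: lenr)
  have "take (j - 1) \<pi> = take d \<pi> @ take (size r) (drop d \<pi>)"
    by (simp add: j_def take_add)
  then have shel: "sheltered \<pi> (d, j) = postorder_reading r"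
    using d unfolding drop by (simp add: sheltered_def lenr)
  have jlen: "j \<le> length \<pi>"
    using arg_cong[OF drop, of length] d by (simp add: lenr j_def)
  have entryj: "entry \<pi> j = snd x"
  proof -
    have "entry \<pi> j = drop d \<pi> ! size r" using d by (simp add: entry_def j_def)
    then show ?thesis unfolding drop by (simp add: nth_append lenr)
  qed
  have entryd: "entry \<pi> d = snd (value l)"
  proof -
    have "entry \<pi> d = last (take d \<pi>)"
      using d by (subst last_conv_nth) (auto simp: entry_def min_def)
    then show ?thesis
      unfolding take using l by (simp add: last_map postorder_eq_Nil_iff last_postorder)
  qed
  have hsub: "heap_ordered (Node l x r)" using heap_ordered_subtree_at[OF h, of p] sub by simp
  have "value l \<in> set_tree l" using l by (cases l) auto
  then have hook: "(d, j) \<in> SW \<pi> d"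
    using hsub jlen d entryd entryj by (auto simp: SW_def hooks_def j_def)
  have readU: "postorder_reading U = unsheltered \<pi> (d, j)"
    by (simp add: U_def postorder_reading_def postorder_replace_at[OF p] unsheltered_def take dropj)
  have pv: "p \<in> vertices (skel T)" using p by (simp add: vertices_skel)
  have subs: "subtree_at (skel T) p = Node (skel l) (fst x) (skel r)"
    by (simp add: skel_def subtree_at_map_tree sub)
  have two: "has_two_children (skel T) p"
    using l r by (simp add: has_two_children_def subs skel_eq_Leaf_iff)
  have "vertex_value (skel T) p = b"
    using assms(1) TT pv two by (auto simp: troupe_def)
  then have black: "fst x = b" by (simp add: vertex_value_def subs)
  have "decomposition p (skel T) \<in> TT \<times> TT"
    using assms(1) TT pv two by (auto simp: troupe_def)
  then have skelU: "skel U \<in> TT" and skelr: "skel r \<in> TT"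
    by (auto simp: decomposition_def subs U_def) (simp add: skel_def flip: replace_at_map_tree)
  have "heap_ordered U"
    unfolding U_def using h hsub by (intro heap_ordered_replace_at_if_subset) (auto simp: sub)
  then have "decreasing_tree U"
    using decreasing_tree_iff_heap_ordered[of U] readU
      permutation_unsheltered[OF assms(2), of "(d, j)"] by (simp add: j_def)
  then have U: "U \<in> postorder_fiber (unsheltered \<pi> (d, j)) \<inter> decreasing_trees TT"
    using readU skelU by (simp add: postorder_fiber_def decreasing_trees_def)
  have "decreasing_tree r"
    using decreasing_tree_iff_heap_ordered[of r] hsub shel
      permutation_sheltered[OF assms(2), of "(d, j)"] by simp
  then have S: "r \<in> postorder_fiber (sheltered \<pi> (d, j)) \<inter> decreasing_trees TT"
    using shel skelr by (simp add: postorder_fiber_def decreasing_trees_def)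
  have subU: "subtree_at U p = l" unfolding U_def by (rule subtree_at_replace_at[OF p])
  have "vertex_at U d = p"
    using l len by (intro vertex_at_eqI)
      (auto simp: vertices_iff_subtree_at subU position_def, simp add: U_def before_replace_at)
  moreover have "insertion x p U r = T"
    using replace_at_subtree_at[of T p]
    by (simp add: insertion_def subU) (simp add: U_def replace_at_replace_at sub)
  moreover have "(b, entry \<pi> j) = x" using black entryj by (simp add: prod_eq_iff)
  ultimately have "labeled_insertion b \<pi> (d, j) U r = T"
    by (simp add: labeled_insertion_def)
  with hook U S show ?thesis by blast
qed

text \<open>
  In the common tree both \<open>p @ [LC]\<close> and \<open>p' @ [LC]\<close> are vertices in position \<open>d\<close>, hence they
  coincide, and decomposition at \<open>p\<close> returns both pairs of trees.  The northeast endpoint is then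
  determined by the size of \<open>S\<close>.
\<close>

lemma labeled_insertion_inject:
  assumes "(d, j) \<in> SW \<pi> d" "(d, j') \<in> SW \<pi> d"
    and U: "U \<in> postorder_fiber (unsheltered \<pi> (d, j))"
    and U': "U' \<in> postorder_fiber (unsheltered \<pi> (d, j'))"
    and S: "S \<in> postorder_fiber (sheltered \<pi> (d, j))"
    and S': "S' \<in> postorder_fiber (sheltered \<pi> (d, j'))"
    and eq: "labeled_insertion b \<pi> (d, j) U S = labeled_insertion b \<pi> (d, j') U' S'"
  shows "j = j' \<and> U = U' \<and> S = S'"
proof -
  define p p' where "p = vertex_at U d" and "p' = vertex_at U' d"
  have p: "p \<in> vertices U" "position U p = d" and p': "p' \<in> vertices U'" "position U' p' = d"
    using vertex_at_unsheltered[OF assms(1) U] vertex_at_unsheltered[OF assms(2) U']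
    by (simp_all add: p_def p'_def)
  let ?T = "insertion (b, entry \<pi> j) p U S"
  have eq: "?T = insertion (b, entry \<pi> j') p' U' S'"
    using eq by (simp add: labeled_insertion_def p_def p'_def)
  have "p @ [LC] = p' @ [LC]"
  proof (rule inj_onD[OF inj_on_position[of ?T]])
    show "position ?T (p @ [LC]) = position ?T (p' @ [LC])"
      using position_insertion_snoc_LC(2)[OF p(1)] position_insertion_snoc_LC(2)[OF p'(1)] p(2) p'(2)
      by (metis eq)
    show "p @ [LC] \<in> vertices ?T" using position_insertion_snoc_LC(1)[OF p(1)] .
    show "p' @ [LC] \<in> vertices ?T" unfolding eq using position_insertion_snoc_LC(1)[OF p'(1)] .
  qed
  then have "p = p'" by simp
  then have US: "U = U'" "S = S'"
    using decomposition_insertion[OF p(1)] decomposition_insertion[OF p'(1)] eq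
    by (metis prod.inject)+
  have len: "length (postorder_reading S) = k - 1 - d"
    if "(d, k) \<in> SW \<pi> d" "S \<in> postorder_fiber (sheltered \<pi> (d, k))" for k
    using that by (auto simp: postorder_fiber_def sheltered_def SW_def hooks_def)
  have "j - 1 - d = j' - 1 - d"
    using len[OF assms(1) S] len[OF assms(2)] S' US by simp
  moreover have "d < j" "d < j'" using assms(1,2) by (auto simp: SW_def hooks_def)
  ultimately show ?thesis using US by simp
qed

lemma bij_betw_labeled_insertion:
  assumes "troupe b TT" "permutation \<pi>" "right_bound_descent \<pi> d"
  shows "bij_betw (\<lambda>(H, U, S). labeled_insertion b \<pi> H U S)
    (SIGMA H:SW \<pi> d. (postorder_fiber (unsheltered \<pi> H) \<inter> decreasing_trees TT) \<times>
      (postorder_fiber (sheltered \<pi> H) \<inter> decreasing_trees TT))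
    (postorder_fiber \<pi> \<inter> decreasing_trees TT)"
    (is "bij_betw ?G ?A ?B")
proof -
  have fst_SW: "fst H = d" if "H \<in> SW \<pi> d" for H using that by (simp add: SW_def)
  have "inj_on ?G ?A"
  proof (rule inj_onI)
    fix X X' assume *: "X \<in> ?A" "X' \<in> ?A" "?G X = ?G X'"
    obtain j U S where X: "X = ((d, j), U, S)"
      using *(1) fst_SW by (cases X) fastforce
    obtain j' U' S' where X': "X' = ((d, j'), U', S')"
      using *(2) fst_SW by (cases X') fastforce
    show "X = X'"
      using * labeled_insertion_inject[of d j \<pi> j' U U' S S' b] unfolding X X' by auto
  qed
  moreover have "?G ` ?A \<subseteq> ?B"
  proof (rule image_subsetI)
    fix X assume *: "X \<in> ?A"
    obtain j U S where X: "X = ((d, j), U, S)"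
      using * fst_SW by (cases X) fastforce
    show "?G X \<in> ?B"
      using * labeled_insertion_in_fiber(2)[OF assms, of j U S] unfolding X by auto
  qed
  moreover have "?B \<subseteq> ?G ` ?A"
  proof
    fix T assume "T \<in> ?B"
    moreover have "d \<in> descents \<pi>" using assms(3) by (simp add: right_bound_descent_def)
    ultimately obtain j U S where "((d, j), U, S) \<in> ?A" "?G ((d, j), U, S) = T"
      using ex_labeled_insertion[OF assms(1,2)] by fastforce
    then show "T \<in> ?G ` ?A" by (intro image_eqI[OF sym])
  qed
  ultimately show ?thesis unfolding bij_betw_def by blast
qed

theorem theorem3p1:
  fixes black white :: "'c::finite"
    and TT :: "'c tree set"
    and r :: nat
    and f :: "nat \<Rightarrow> 'c tree \<Rightarrow> complex"
    and \<pi> :: "nat list"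
    and d :: nat
  assumes "black \<noteq> white"
    and "troupe black TT"
    and "\<forall>i\<in>{1..r}. insertion_additive black (f i)"
    and "permutation \<pi>"
    and "\<pi> \<noteq> []"
    and "right_bound_descent \<pi> d"
  shows "(\<Sum>\<T>\<in>postorder_fiber \<pi> \<inter> decreasing_trees TT. \<Prod>i=1..r. var_power i (ddot (f i) \<T>)) =
    (\<Sum>H\<in>SW \<pi> d.
      (\<Sum>\<T>\<^sub>U\<in>postorder_fiber (unsheltered \<pi> H) \<inter> decreasing_trees TT.
         \<Prod>i=1..r. var_power i (ddot (f i) \<T>\<^sub>U)) *
      (\<Sum>\<T>\<^sub>S\<in>postorder_fiber (sheltered \<pi> H) \<inter> decreasing_trees TT.
         \<Prod>i=1..r. var_power i (ddot (f i) \<T>\<^sub>S)))"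
proof -
  let ?w = "\<lambda>\<T>. \<Prod>i=1..r. var_power i (ddot (f i) \<T>)"
  let ?U = "\<lambda>H. postorder_fiber (unsheltered \<pi> H) \<inter> decreasing_trees TT"
  let ?S = "\<lambda>H. postorder_fiber (sheltered \<pi> H) \<inter> decreasing_trees TT"
  have weight: "?w (labeled_insertion black \<pi> H U S) = ?w U * ?w S"
    if "H \<in> SW \<pi> d" "U \<in> ?U H" "S \<in> ?S H" for H U S
  proof -
    have "H = (d, snd H)" using that(1) by (auto simp: SW_def)
    then obtain j where H: "H = (d, j)" ..
    have p: "vertex_at U d \<in> vertices U"
      using vertex_at_unsheltered(1) that H by blast
    have "S \<noteq> Leaf"
      using labeled_insertion_in_fiber(1)[OF assms(2,4,6)] that unfolding H by blast
    moreover have "U \<noteq> Leaf" using p by auto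
    ultimately have "ddot (f i) (labeled_insertion black \<pi> H U S) = ddot (f i) U + ddot (f i) S"
      if "i \<in> {1..r}" for i
      using assms(3) that p
      by (simp add: insertion_additive_def ddot_def labeled_insertion_def skel_insertion H
          skel_eq_Leaf_iff vertices_skel)
    then show ?thesis
      by (simp add: var_power_add flip: prod.distrib)
  qed
  have "(\<Sum>\<T>\<in>postorder_fiber \<pi> \<inter> decreasing_trees TT. ?w \<T>) =
      (\<Sum>(H, U, S)\<in>(SIGMA H:SW \<pi> d. ?U H \<times> ?S H). ?w (labeled_insertion black \<pi> H U S))"
    by (subst sum.reindex_bij_betw[OF bij_betw_labeled_insertion[OF assms(2,4,6)], symmetric])
       (simp add: case_prod_unfold)
  also have "\<dots> = (\<Sum>(H, U, S)\<in>(SIGMA H:SW \<pi> d. ?U H \<times> ?S H). ?w U * ?w S)"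
    by (rule sum.cong[OF refl]) (use weight in auto)
  also have "\<dots> = (\<Sum>H\<in>SW \<pi> d. \<Sum>(U, S)\<in>?U H \<times> ?S H. ?w U * ?w S)"
    by (subst sum.Sigma) (auto simp: finite_SW finite_postorder_fiber)
  also have "\<dots> = (\<Sum>H\<in>SW \<pi> d. (\<Sum>U\<in>?U H. ?w U) * (\<Sum>S\<in>?S H. ?w S))"
    by (simp add: sum_product sum.cartesian_product)
  finally show ?thesis .
qed

end
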